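(* Let $p,k,n$ be positive integers with $k\ge 4p+1$ and $n\ge 108(2p+1)^{2p}k$. Let $\mathcal C$ be a family of odd cycles in which $C_{2p+1}$ is the shortest odd cycle not in $\mathcal C$ and $C_{2k+1}$ is the longest odd cycle in $\mathcal C$. If $G$ is an $n$-vertex graph containing no member of $\mathcal C$ as a subgraph and $\delta(G)\ge \frac{n}{2(2p+1)}$, then $G$ is bipartite or $G$ is (isomorphic to) $BC_{2p+1}(n)$.
   Context: $C_m$ is the cycle on $m$ vertices and $\delta(G)$ is the minimum degree. $BC_{2p+1}(n)$ denotes the $n$-vertex graph obtained by taking $2p+1$ vertex-disjoint copies of the complete bipartite graph $K_{\frac{n}{2(2p+1)},\frac{n}{2(2p+1)}}$ and selecting one vertex in each copy such that these selected vertices form a cycle of length $2p+1$ (i.e., adding the edges of such a cycle on the selected vertices). *)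

theory Defs
  imports Complex_Main "Graph_Theory.Graph_Theory"
begin

text \<open>
  A finite simple graph is a \<^locale>\<open>pair_graph\<close>: a finite vertex set together with a finite,
  symmetric and irreflexive set of arcs, the edge $uv$ being represented by both $(u,v)$ and $(v,u)$.
  Hence the degree of a vertex is its out-degree.
\<close>

definition min_degree :: "'a pair_pre_digraph \<Rightarrow> nat" where
  "min_degree G = Min ((\<lambda>v. out_degree (with_proj G) v) ` pverts G)"

definition bipartite :: "'a pair_pre_digraph \<Rightarrow> bool" where
  "bipartite G \<longleftrightarrow> (\<exists>X Y. X \<union> Y = pverts G \<and> X \<inter> Y = {} \<and> parcs G \<subseteq> X \<times> Y \<union> Y \<times> X)"

text \<open>Containment is not necessarily induced: some subgraph of \<open>G\<close> is isomorphic to \<open>H\<close>.\<close>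

definition contains_copy :: "'a pair_pre_digraph \<Rightarrow> 'b pair_pre_digraph \<Rightarrow> bool" where
  "contains_copy G H \<longleftrightarrow>
     (\<exists>K :: 'a pair_pre_digraph.
        subgraph (with_proj K) (with_proj G) \<and> digraph_iso (with_proj H) (with_proj K))"

text \<open>The cycle $C_m$ on the vertices $0, \dots, m-1$; meaningful for $m \ge 3$.\<close>

definition cycle_graph :: "nat \<Rightarrow> nat pair_pre_digraph" where
  "cycle_graph m =
     \<lparr> pverts = {..<m},
       parcs = {(i, j). i < m \<and> j < m \<and> (j = (i + 1) mod m \<or> i = (j + 1) mod m)} \<rparr>"

definition odd_cycles :: "nat pair_pre_digraph set" where
  "odd_cycles = {cycle_graph m | m. odd m \<and> 3 \<le> m}"

text \<open>
  \<open>BC m n\<close> is $BC_m(n)$. The vertex \<open>(i, s, a)\<close> is the \<open>a\<close>-th vertex of side \<open>s\<close> in the \<open>i\<close>-th copy of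
  $K_{t,t}$ with $t = n/(2m)$; the vertex selected in the \<open>i\<close>-th copy is \<open>(i, False, 0)\<close>.
  Division truncates, so \<open>BC m n\<close> is the intended \<open>n\<close>-vertex graph only if \<open>2 * m\<close> divides \<open>n\<close>.
\<close>

definition BC :: "nat \<Rightarrow> nat \<Rightarrow> (nat \<times> bool \<times> nat) pair_pre_digraph" where
  "BC m n = (let t = n div (2 * m) in
     \<lparr> pverts = {..<m} \<times> UNIV \<times> {..<t},
       parcs =
         {((i, s, a), (i, s', b)) | i s s' a b. i < m \<and> s \<noteq> s' \<and> a < t \<and> b < t} \<union>
         {((i, False, 0), (j, False, 0)) | i j. (i, j) \<in> parcs (cycle_graph m) \<and> 0 < t} \<rparr>)"

lemma digraph_iso_with_proj_iff:
  assumes "pair_wf_digraph G"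
  shows "digraph_iso (with_proj G) (with_proj H) \<longleftrightarrow>
    (\<exists>f. inj_on f (pverts G) \<and> f ` pverts G = pverts H \<and> map_prod f f ` parcs G = parcs H)"
proof -
  interpret G: pair_wf_digraph G by (fact assms)
  show ?thesis
  proof
    assume "digraph_iso (with_proj G) (with_proj H)"
    then obtain h where h: "pre_digraph.digraph_isomorphism (with_proj G) h"
      and H: "with_proj H = app_iso h (with_proj G)"
      unfolding digraph_iso_def by blast
    let ?f = "iso_verts h"
    have tl: "iso_tail h = fst" "iso_head h = snd"
      and V: "?f ` pverts G = pverts H" and A: "iso_arcs h ` parcs G = parcs H"
      using H by (simp_all add: with_proj_def app_iso_def)
    have "iso_arcs h e = map_prod ?f ?f e" if "e \<in> parcs G" for e
      using h that tl by (cases e) (auto simp: pre_digraph.digraph_isomorphism_def prod_eq_iff)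
    then have "map_prod ?f ?f ` parcs G = parcs H"
      using A by (metis (no_types, lifting) image_cong)
    moreover have "inj_on ?f (pverts G)"
      using h by (simp add: pre_digraph.digraph_isomorphism_def)
    ultimately show "\<exists>f. inj_on f (pverts G) \<and> f ` pverts G = pverts H \<and>
        map_prod f f ` parcs G = parcs H"
      using V by blast
  next
    assume "\<exists>f. inj_on f (pverts G) \<and> f ` pverts G = pverts H \<and> map_prod f f ` parcs G = parcs H"
    then obtain f where f: "inj_on f (pverts G)" "f ` pverts G = pverts H"
      "map_prod f f ` parcs G = parcs H" by blast
    let ?h = "\<lparr> iso_verts = f, iso_arcs = map_prod f f, iso_head = snd, iso_tail = fst \<rparr>"
    have "inj_on (map_prod f f) (parcs G)"
      by (rule inj_on_subset[OF map_prod_inj_on[OF f(1) f(1)]]) (auto dest: G.wellformed')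
    then have "pre_digraph.digraph_isomorphism (with_proj G) ?h"
      using f(1) G.wf_digraph by (simp add: pre_digraph.digraph_isomorphism_def)
    moreover have "with_proj H = app_iso ?h (with_proj G)"
      using f by (simp add: with_proj_def app_iso_def)
    ultimately show "digraph_iso (with_proj G) (with_proj H)"
      unfolding digraph_iso_def by blast
  qed
qed

lemma contains_copy_iff:
  assumes "pair_wf_digraph G" "pair_wf_digraph H"
  shows "contains_copy G H \<longleftrightarrow>
    (\<exists>f. inj_on f (pverts H) \<and> f ` pverts H \<subseteq> pverts G \<and> map_prod f f ` parcs H \<subseteq> parcs G)"
proof -
  interpret G: pair_wf_digraph G by (fact assms)
  interpret H: pair_wf_digraph H by (fact assms)
  show ?thesis
  proof
    assume "contains_copy G H"
    then show "\<exists>f. inj_on f (pverts H) \<and> f ` pverts H \<subseteq> pverts G \<and>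
        map_prod f f ` parcs H \<subseteq> parcs G"
      unfolding contains_copy_def digraph_iso_with_proj_iff[OF assms(2)] subgraph_def
      by (metis with_proj_simps(1,2))
  next
    assume "\<exists>f. inj_on f (pverts H) \<and> f ` pverts H \<subseteq> pverts G \<and> map_prod f f ` parcs H \<subseteq> parcs G"
    then obtain f where f: "inj_on f (pverts H)" "f ` pverts H \<subseteq> pverts G"
      "map_prod f f ` parcs H \<subseteq> parcs G" by blast
    let ?K = "\<lparr> pverts = f ` pverts H, parcs = map_prod f f ` parcs H \<rparr>"
    have "wf_digraph (with_proj ?K)"
      by unfold_locales (auto dest: H.wellformed')
    then have "subgraph (with_proj ?K) (with_proj G)"
      using f G.wf_digraph by (simp add: subgraph_def compatible_def)
    moreover have "digraph_iso (with_proj H) (with_proj ?K)"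
      using f(1) by (auto simp: digraph_iso_with_proj_iff[OF assms(2)])
    ultimately show "contains_copy G H"
      unfolding contains_copy_def by blast
  qed
qed

lemma pair_graph_cycle_graph:
  assumes "3 \<le> m"
  shows "pair_graph (cycle_graph m)"
proof -
  have fin: "finite (parcs (cycle_graph m))"
    by (rule finite_subset[of _ "{..<m} \<times> {..<m}"]) (auto simp: cycle_graph_def)
  have neq: "i \<noteq> Suc i mod m" if "i < m" for i
    using assms that by (cases "Suc i = m") auto
  show ?thesis
    using fin
    by unfold_locales
      (auto simp: cycle_graph_def symmetric_def sym_def with_proj_def arcs_ends_conv dest: neq)
qed

lemma pair_graph_BC:
  assumes "3 \<le> m"
  shows "pair_graph (BC m n)"
proof -
  interpret C: pair_graph "cycle_graph m"
    by (rule pair_graph_cycle_graph[OF assms])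
  have loop: "(i, i) \<notin> parcs (cycle_graph m)" for i
    using C.pair_no_loops by fastforce
  have inC: "i < m" "j < m" if "(i, j) \<in> parcs (cycle_graph m)" for i j
    using that by (auto simp: cycle_graph_def)
  have symC: "(j, i) \<in> parcs (cycle_graph m)" if "(i, j) \<in> parcs (cycle_graph m)" for i j
    using that by (auto simp: cycle_graph_def)
  have sub: "parcs (BC m n) \<subseteq> pverts (BC m n) \<times> pverts (BC m n)"
    by (auto simp: BC_def Let_def dest: inC)
  have finV: "finite (pverts (BC m n))"
    by (simp add: BC_def Let_def)
  have "finite (parcs (BC m n))"
    using finite_subset[OF sub] finV by blast
  moreover have "sym (parcs (BC m n))"
    by (rule symI) (auto simp: BC_def Let_def dest: symC)
  moreover have "fst e \<noteq> snd e" if "e \<in> parcs (BC m n)" for e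
    using that loop by (auto simp: BC_def Let_def)
  ultimately show ?thesis
    using finV sub by unfold_locales (auto simp: symmetric_def)
qed

lemma card_BC: "2 * m dvd n \<Longrightarrow> card (pverts (BC m n)) = n"
  by (auto simp: BC_def Let_def card_cartesian_product)

lemma BC_copy_complete_bipartite:
  assumes "i < m" "3 \<le> m"
  shows "complete_bipartite_digraph (n div (2 * m)) (n div (2 * m))
           (with_proj (BC m n) \<restriction> ({i} \<times> UNIV \<times> {..<n div (2 * m)}))"
proof -
  let ?t = "n div (2 * m)"
  let ?V = "{i} \<times> (UNIV :: bool set) \<times> {..<?t}"
  let ?A = "\<lambda>s. {i} \<times> {s :: bool} \<times> {..<?t}"
  interpret B: pair_graph "BC m n"
    by (rule pair_graph_BC[OF assms(2)])
  interpret C: pair_graph "cycle_graph m"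
    by (rule pair_graph_cycle_graph[OF assms(2)])
  have loop: "(j, j) \<notin> parcs (cycle_graph m)" for j
    using C.pair_no_loops by fastforce
  have V: "?V \<subseteq> pverts (BC m n)"
    using assms(1) by (auto simp: BC_def Let_def)
  have ind: "induced_subgraph (with_proj (BC m n) \<restriction> ?V) (with_proj (BC m n))"
    using V by (intro B.induced_induce) simp
  have g: "graph (with_proj (BC m n) \<restriction> ?V)"
    using ind
    by (intro digraph.graphI B.digraphI_induced
        induced_graph_imp_symmetric[OF B.pair_sym_arcs])
  have arcs: "arcs_ends (with_proj (BC m n) \<restriction> ?V) =
      ?A False \<times> ?A True \<union> ?A True \<times> ?A False"
    using assms(1) loop
    by (auto simp: arcs_ends_conv induce_subgraph_def BC_def Let_def image_iff)
  show ?thesis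
    unfolding complete_bipartite_digraph_def
    by (intro conjI g exI[of _ "?A False"] exI[of _ "?A True"] arcs)
      (auto simp: induce_subgraph_def card_cartesian_product)
qed

end

theory Submission
  imports Defs
begin

text \<open>
  Put $m = 2p+1$ and call two vertices linked if they have at least $2mk$ common neighbours.
  Inclusion-exclusion shows that among any $2m+1$ vertices two are linked, so every set of more than
  $2m(t-1)$ vertices contains a path of $t$ successively linked vertices. Routing such a path through
  the common neighbourhood of two linked vertices $x, y$ joins them by paths of all small even
  lengths; since $C_{2k+1}$ is excluded, no path of odd length below $2k$ joins $x$ to $y$.

  If $G$ is not bipartite, each vertex has at most two neighbours on a shortest odd cycle
  $v_0, \dots, v_{l-1}$, unless $l = 3$, so $l \le 4m$ and hence $l < 2k$. Choose a neighbour $u_i$ of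
  each $v_i$ that is off the cycle and not adjacent to the other $v_j$. The $2l$ vertices $v_i, u_i$
  are pairwise joined by short odd paths, hence not linked, so $l \le m$, that is $l = m$. Every other
  vertex is linked to one of these $2m$ vertices, which splits the vertex set into $2m$ classes, and
  the same parity argument confines all edges except those of the cycle to the pairs of classes of
  $v_i$ and $u_i$. The minimum degree then forces all classes to have exactly $n/(2m)$ elements and
  these pairs to be complete bipartite.
\<close>

section \<open>Independent sets and unions\<close>

text \<open>A longest path cannot be extended at its head, so its head is unrelated to everything
  off the path. If it has fewer than \<open>t\<close> vertices, delete them, apply induction on
  \<open>\<alpha>\<close> and add the head to the independent set obtained.\<close>

lemma path_or_independent_set:
  fixes R :: "'a \<Rightarrow> 'a \<Rightarrow> bool"
  assumes "finite S" "\<alpha> * (t - 1) < card S" and sym: "\<And>x y. R x y \<Longrightarrow> R y x"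
  shows "(\<exists>xs. distinct xs \<and> set xs \<subseteq> S \<and> length xs = t \<and> successively R xs) \<or>
    (\<exists>I \<subseteq> S. card I = Suc \<alpha> \<and> pairwise (\<lambda>x y. \<not> R x y) I)"
  using assms(1,2)
proof (induction \<alpha> arbitrary: S)
  case 0
  then obtain x where "x \<in> S" by fastforce
  then have "\<exists>I \<subseteq> S. card I = Suc 0 \<and> pairwise (\<lambda>x y. \<not> R x y) I"
    by (intro exI[of _ "{x}"]) auto
  then show ?case by simp
next
  case (Suc \<alpha>)
  show ?case
    unfolding disj_imp
  proof (rule impI)
    assume no_path: "\<not> (\<exists>xs. distinct xs \<and> set xs \<subseteq> S \<and> length xs = t \<and> successively R xs)"
    let ?P = "\<lambda>xs. distinct xs \<and> set xs \<subseteq> S \<and> successively R xs"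
    obtain x where x: "x \<in> S" using Suc.prems by fastforce
    have "length xs < Suc (card S)" if "?P xs" for xs
      using that Suc.prems(1) by (metis card_mono distinct_card le_imp_less_Suc)
    then obtain xs where xs: "?P xs" and max: "\<And>ys. ?P ys \<Longrightarrow> length ys \<le> length xs"
      using ex_has_greatest_nat[of ?P "[]" length "Suc (card S)"] by auto
    have "xs \<noteq> []" using max[of "[x]"] x by auto
    have "length xs < t"
    proof (rule ccontr)
      assume "\<not> length xs < t"
      moreover have "successively R (take t xs)"
        using xs successively_append_iff[of R "take t xs" "drop t xs"] by simp
      ultimately show False
        using no_path xs set_take_subset[of t xs]
        by (metis distinct_take length_take linorder_not_less min.absorb2 subset_trans)
    qed
    let ?S = "S - set xs"
    have "card S - card (set xs) \<le> card ?S" by (rule diff_card_le_card_Diff) simp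
    moreover have "card (set xs) = length xs" using xs by (simp add: distinct_card)
    ultimately have "\<alpha> * (t - 1) < card ?S" using Suc.prems(2) \<open>length xs < t\<close> by simp
    moreover have "\<not> (\<exists>xs. distinct xs \<and> set xs \<subseteq> ?S \<and> length xs = t \<and> successively R xs)"
      using no_path by blast
    ultimately obtain I where I: "I \<subseteq> ?S" "card I = Suc \<alpha>" "pairwise (\<lambda>x y. \<not> R x y) I"
      using Suc.IH[of ?S] Suc.prems(1) by blast
    have "\<not> R (hd xs) y" if "y \<in> I" for y
    proof
      assume "R (hd xs) y"
      then have "?P (y # xs)"
        using that I(1) xs sym \<open>xs \<noteq> []\<close> by (auto simp: successively_Cons)
      then show False using max by fastforce
    qed
    then have "pairwise (\<lambda>x y. \<not> R x y) (insert (hd xs) I)"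
      using I(3) sym by (auto simp: pairwise_insert)
    moreover have "hd xs \<notin> I" "hd xs \<in> S" using I(1) xs \<open>xs \<noteq> []\<close> by auto
    moreover have "finite I" using I(1) Suc.prems(1) by (meson finite_Diff finite_subset)
    ultimately show "\<exists>I \<subseteq> S. card I = Suc (Suc \<alpha>) \<and> pairwise (\<lambda>x y. \<not> R x y) I"
      using I by (intro exI[of _ "insert (hd xs) I"]) auto
  qed
qed

text \<open>Bonferroni's inequality, doubled so that the number of pairs needs no division.\<close>

lemma sum_card_le_card_UN:
  fixes N :: "'a \<Rightarrow> 'b set"
  assumes "finite S" "\<And>x. x \<in> S \<Longrightarrow> finite (N x) \<and> d \<le> card (N x)"
    and "pairwise (\<lambda>x y. card (N x \<inter> N y) \<le> K) S"
  shows "2 * card S * d \<le> 2 * card (\<Union>x\<in>S. N x) + card S * (card S - 1) * K"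
  using assms
proof (induction S)
  case empty
  then show ?case by simp
next
  case (insert x S)
  let ?U = "\<Union>y\<in>S. N y"
  have fin: "finite (N x)" "finite ?U" using insert by auto
  have "N x \<inter> ?U = (\<Union>y\<in>S. N x \<inter> N y)" by auto
  then have "card (N x \<inter> ?U) \<le> (\<Sum>y\<in>S. card (N x \<inter> N y))"
    using card_UN_le[OF insert.hyps(1)] by metis
  also have "\<dots> \<le> (\<Sum>y\<in>S. K)"
    using insert.prems(2) insert.hyps by (intro sum_mono) (auto simp: pairwise_insert)
  finally have "card (N x \<inter> ?U) \<le> card S * K" by simp
  moreover have "card (N x) + card ?U = card (N x \<union> ?U) + card (N x \<inter> ?U)"
    using card_Un_Int[OF fin] .
  moreover have "d \<le> card (N x)" using insert.prems by simp
  moreover have "2 * card S * d \<le> 2 * card ?U + card S * (card S - 1) * K"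
    using insert by (auto simp: pairwise_insert)
  moreover have "card S * (card S - 1) + 2 * card S = Suc (card S) * card S"
    by (cases "card S") auto
  then have "card S * (card S - 1) * K + 2 * (card S * K) = Suc (card S) * card S * K"
    by (metis distrib_right mult.assoc)
  moreover have "2 * Suc (card S) * d = 2 * card S * d + 2 * d" by simp
  ultimately show ?case using insert.hyps by simp
qed

section \<open>Shortest odd closed walks\<close>

lemma sym_relpow: "sym E \<Longrightarrow> (x, y) \<in> E ^^ n \<Longrightarrow> (y, x) \<in> E ^^ n"
proof (induction n arbitrary: y)
  case (Suc n)
  then obtain z where "(x, z) \<in> E ^^ n" "(z, y) \<in> E" by auto
  then show ?case using Suc by (meson relpow_Suc_I2 symD)
qed simp

lemma relpow_add_I: "(x, y) \<in> E ^^ a \<Longrightarrow> (y, z) \<in> E ^^ b \<Longrightarrow> (x, z) \<in> E ^^ (a + b)"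
  by (auto simp: relpow_add)

text \<open>Colour each vertex by the parity of a walk from a root of its component. An edge inside
  a colour class would close two such walks to an odd closed walk.\<close>

lemma two_colouring_if_no_odd_closed_walk:
  assumes "sym E" "E \<subseteq> V \<times> V" and no_odd: "\<And>x n. odd n \<Longrightarrow> (x, x) \<notin> E ^^ n"
  shows "\<exists>X Y. X \<union> Y = V \<and> X \<inter> Y = {} \<and> E \<subseteq> X \<times> Y \<union> Y \<times> X"
proof -
  define r where "r x = (SOME y. (x, y) \<in> E\<^sup>*)" for x
  have r: "(x, r x) \<in> E\<^sup>*" for x
    unfolding r_def by (rule someI[of _ x]) simp
  \<comment> \<open>Adjacent vertices reach the same vertices, so \<open>SOME\<close> picks the same
    root for both.\<close>
  have r_eq: "r x = r y" if "(x, y) \<in> E" for x y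
  proof -
    have "(x, z) \<in> E\<^sup>* \<longleftrightarrow> (y, z) \<in> E\<^sup>*" for z
      using that symD[OF assms(1) that] by (meson converse_rtrancl_into_rtrancl)
    then show ?thesis by (simp add: r_def)
  qed
  define X where "X = {x \<in> V. \<exists>n. even n \<and> (r x, x) \<in> E ^^ n}"
  have walk: "\<exists>n. (r x, x) \<in> E ^^ n \<and> (odd n \<longleftrightarrow> x \<notin> X)" if "x \<in> V" for x
    using r[of x] that sym_relpow[OF assms(1)] unfolding X_def rtrancl_power by blast
  have "x \<in> X \<longleftrightarrow> y \<notin> X" if e: "(x, y) \<in> E" for x y
  proof (rule ccontr)
    assume same: "\<not> (x \<in> X \<longleftrightarrow> y \<notin> X)"
    obtain a where a: "(r x, x) \<in> E ^^ a" "odd a \<longleftrightarrow> x \<notin> X" using walk e assms(2) by blast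
    obtain b where b: "(r y, y) \<in> E ^^ b" "odd b \<longleftrightarrow> y \<notin> X" using walk e assms(2) by blast
    have "(r x, y) \<in> E ^^ (Suc a)" using a(1) e by auto
    from relpow_add_I[OF this sym_relpow[OF assms(1) b(1)]]
    have "(r x, r x) \<in> E ^^ (Suc a + b)" using r_eq[OF e] by simp
    moreover have "odd (Suc a + b)" using a(2) b(2) same by auto
    ultimately show False using no_odd by blast
  qed
  then have "E \<subseteq> X \<times> (V - X) \<union> (V - X) \<times> X" using assms(2) by blast
  moreover have "X \<subseteq> V" by (simp add: X_def)
  ultimately show ?thesis by (intro exI[of _ X] exI[of _ "V - X"] conjI) blast+
qed

text \<open>Minimality is over closed walks rather than cycles, so concatenated walks can be
  compared with \<open>l\<close> without checking that their vertices are distinct.\<close>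

locale shortest_odd_walk =
  fixes E :: "'a rel" and v :: "nat \<Rightarrow> 'a" and l :: nat
  assumes sym: "sym E" and odd_l: "odd l" and closed: "v l = v 0"
    and step: "\<And>i. i < l \<Longrightarrow> (v i, v (Suc i)) \<in> E"
    and shortest: "\<And>x q. (x, x) \<in> E ^^ q \<Longrightarrow> odd q \<Longrightarrow> l \<le> q"
begin

lemma walk_along: "i \<le> j \<Longrightarrow> j \<le> l \<Longrightarrow> (v i, v j) \<in> E ^^ (j - i)"
proof (induction j)
  case (Suc j)
  show ?case
  proof (cases "i = Suc j")
    case False
    then have "(v i, v j) \<in> E ^^ (j - i)" "Suc j - i = Suc (j - i)" using Suc by auto
    then show ?thesis using step[of j] Suc.prems by auto
  qed simp
qed simp

text \<open>The two arcs between \<open>v i\<close> and \<open>v j\<close> have lengths of opposite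
  parity, as \<open>l\<close> is odd. A walk of length \<open>q\<close> closes exactly one of them
  to an odd closed walk, whose length is at least \<open>l\<close>. The cases
  \<open>q = 0, 1, 2\<close> give injectivity, the absence of chords and the position of common
  neighbours.\<close>

lemma shortcut:
  assumes "i < j" "j < l" "(v i, v j) \<in> E ^^ q"
  shows "odd (q + (j - i)) \<Longrightarrow> l \<le> q + (j - i)" and "even (q + (j - i)) \<Longrightarrow> j - i \<le> q"
proof -
  have rev: "(v j, v i) \<in> E ^^ q" using sym_relpow[OF sym assms(3)] .
  have "(v i, v i) \<in> E ^^ ((j - i) + q)"
    using relpow_add_I[OF walk_along rev] assms by simp
  then show "odd (q + (j - i)) \<Longrightarrow> l \<le> q + (j - i)"
    using shortest by (metis add.commute)
  have "(v j, v i) \<in> E ^^ ((l - j) + (i - 0))"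
    using relpow_add_I[OF walk_along[of j l], of "v i" "i - 0"] walk_along[of 0 i] closed assms
    by simp
  from relpow_add_I[OF this assms(3)] have "(v j, v j) \<in> E ^^ (l - (j - i) + q)"
    using assms by (simp add: algebra_simps)
  then have "odd (l - (j - i) + q) \<Longrightarrow> l \<le> l - (j - i) + q" using shortest by blast
  then show "even (q + (j - i)) \<Longrightarrow> j - i \<le> q"
    using assms odd_l by (cases "even q") auto
qed

lemma inj: "inj_on v {..<l}"
proof (rule linorder_inj_onI)
  fix i j assume ij: "i < j" "i \<in> {..<l}" "j \<in> {..<l}"
  show "v i \<noteq> v j"
  proof
    assume "v i = v j"
    then have "(v i, v j) \<in> E ^^ 0" by simp
    from shortcut[OF _ _ this] ij show False by (cases "even (j - i)") auto
  qed
qed auto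

lemma chordless:
  assumes "i < l" "j < l" "(v i, v j) \<in> E"
  shows "j = Suc i mod l \<or> i = Suc j mod l"
proof -
  have *: "j = Suc i mod l \<or> i = Suc j mod l" if "i < j" "j < l" "(v i, v j) \<in> E" for i j
  proof -
    have "(v i, v j) \<in> E ^^ 1" using that by simp
    note s = shortcut[OF that(1,2) this]
    show ?thesis
    proof (cases "even (j - i)")
      case True
      then have "Suc j = l" "i = 0" using s(1) that by auto
      then show ?thesis by simp
    next
      case False
      then have "j = Suc i" using s(2) that by auto
      then show ?thesis using that by simp
    qed
  qed
  show ?thesis
  proof (cases "i = j")
    case True
    then have "(v i, v i) \<in> E ^^ 1" using assms by simp
    then have "l \<le> 1" using shortest by (metis odd_one)
    then have "l = 1" "i = 0" "j = 0" using assms True by auto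
    then show ?thesis by simp
  next
    case False
  then show ?thesis using *[of i j] *[of j i] assms symD[OF sym] by (meson linorder_neqE_nat)
  qed
qed

lemma common_neighbour:
  assumes "i < j" "j < l" "(v i, x) \<in> E" "(v j, x) \<in> E"
  shows "j = i + 2 \<or> j = i + (l - 2)"
proof -
  have "(x, v j) \<in> E" using assms(4) sym by (auto dest: symD)
  then have "(v i, v j) \<in> E ^^ 2" using assms(3) by (auto simp: numeral_2_eq_2)
  note s = shortcut[OF assms(1,2) this]
  show ?thesis
  proof (cases "even (j - i)")
    case True
    then have "j - i \<le> 2" using s(2) by simp
    moreover have "j - i \<noteq> 1" using True by (metis odd_one)
    ultimately show ?thesis using assms(1) by linarith
  next
    case False
    then have "l \<le> 2 + (j - i)" using s(1) by simp
    moreover have "even (l - 1)" using odd_l by simp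
    then have "j - i \<noteq> l - 1" using False by metis
    ultimately show ?thesis using assms(1,2) by linarith
  qed
qed

text \<open>By \<open>common_neighbour\<close> any further index is at distance \<open>2\<close> or
  \<open>l - 2\<close> from the smallest one \<open>a\<close>. Having both would leave a gap of
  \<open>l - 4\<close>, which must again be \<open>2\<close> or \<open>l - 2\<close>, against
  \<open>l\<close> being odd.\<close>

lemma card_neighbours_on_walk:
  assumes "5 \<le> l"
  shows "card {i \<in> {..<l}. (v i, x) \<in> E} \<le> 2"
proof (cases "{i \<in> {..<l}. (v i, x) \<in> E} = {}")
  case False
  let ?I = "{i \<in> {..<l}. (v i, x) \<in> E}"
  have fin: "finite ?I" by simp
  define a where "a = Min ?I"
  have a: "a \<in> ?I" using Min_in[OF fin False] by (simp add: a_def)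
  have near: "j = a \<or> j = a + 2 \<or> j = a + (l - 2)" if "j \<in> ?I" for j
  proof -
    have "a \<le> j" using Min_le[OF fin that] by (simp only: a_def)
    then show ?thesis using common_neighbour[of a j x] a that by (cases "a = j") auto
  qed
  have "\<not> (a + 2 \<in> ?I \<and> a + (l - 2) \<in> ?I)"
  proof
    assume "a + 2 \<in> ?I \<and> a + (l - 2) \<in> ?I"
    then have "a + (l - 2) = a + 2 + 2 \<or> a + (l - 2) = a + 2 + (l - 2)"
      using common_neighbour[of "a + 2" "a + (l - 2)" x] assms by auto
    then have "l = 6" using assms by auto
    then show False using odd_l by simp
  qed
  then have "?I \<subseteq> {a, a + 2} \<or> ?I \<subseteq> {a, a + (l - 2)}" using near by blast
  moreover have "card {a, a + 2} \<le> 2" "card {a, a + (l - 2)} \<le> 2"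
    by (simp_all add: card_insert_if)
  ultimately show ?thesis by (meson card_mono finite.emptyI finite.insertI le_trans)
qed (metis card.empty zero_le)

text \<open>Double counting of the pairs of an index \<open>i\<close> and a neighbour of
  \<open>v i\<close>.\<close>

lemma length_times_degree:
  assumes "5 \<le> l" "finite V" "E \<subseteq> V \<times> V" and deg: "\<And>x. x \<in> V \<Longrightarrow> d \<le> card (E `` {x})"
  shows "l * d \<le> 2 * card V"
proof -
  have N: "{x \<in> V. (v i, x) \<in> E} = E `` {v i}" for i using assms(3) by auto
  have "l * d = (\<Sum>i<l. d)" by simp
  also have "\<dots> \<le> (\<Sum>i<l. card {x \<in> V. (v i, x) \<in> E})"
  proof (rule sum_mono)
    fix i assume "i \<in> {..<l}"
    then have "v i \<in> V" using step[of i] assms(3) by blast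
    then show "d \<le> card {x \<in> V. (v i, x) \<in> E}" using deg N by simp
  qed
  also have "\<dots> = (\<Sum>x\<in>V. card {i \<in> {..<l}. (v i, x) \<in> E})"
    using assms(2) by (intro sum_multicount_gen) auto
  also have "\<dots> \<le> (\<Sum>x\<in>V. 2)" by (rule sum_mono) (rule card_neighbours_on_walk[OF assms(1)])
  finally show ?thesis by simp
qed

lemma cycle_step: "i < l \<Longrightarrow> (v i, v (Suc i mod l)) \<in> E"
  using step[of i] closed by (cases "Suc i = l") auto

end

lemma shortest_odd_walk_exists:
  assumes "sym E" "odd n" "(x, x) \<in> E ^^ n"
  shows "\<exists>v l. shortest_odd_walk E v l"
proof -
  define l where "l = (LEAST n. odd n \<and> (\<exists>x. (x, x) \<in> E ^^ n))"
  have "\<exists>n. odd n \<and> (\<exists>x. (x, x) \<in> E ^^ n)" using assms(2,3) by blast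
  then have "odd l \<and> (\<exists>x. (x, x) \<in> E ^^ l)" unfolding l_def by (rule LeastI_ex)
  then obtain y where l: "odd l" "(y, y) \<in> E ^^ l" by blast
  have least: "l \<le> q" if "(z, z) \<in> E ^^ q" "odd q" for z q
    unfolding l_def using that by (intro Least_le conjI exI)
  from l(2) obtain v where "v 0 = y" "v l = y" "\<forall>i<l. (v i, v (Suc i)) \<in> E"
    by (auto simp: relpow_fun_conv)
  then have "shortest_odd_walk E v l" using assms(1) l(1) least by unfold_locales auto
  then show ?thesis by blast
qed

section \<open>Linked vertices\<close>

text \<open>The length of the list counts vertices: a list of even length is a path of odd
  length.\<close>

definition is_path :: "'a rel \<Rightarrow> 'a list \<Rightarrow> 'a \<Rightarrow> 'a \<Rightarrow> bool" where
  "is_path E xs x y \<longleftrightarrow> xs \<noteq> [] \<and> hd xs = x \<and> last xs = y \<and> distinct xs \<and>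
     successively (\<lambda>u v. (u, v) \<in> E) xs"

lemma is_path_append:
  assumes "is_path E xs x y" "is_path E ys y' z" "(y, y') \<in> E" "set xs \<inter> set ys = {}"
  shows "is_path E (xs @ ys) x z"
  using assms by (auto simp: is_path_def successively_append_iff)

lemma is_path_Cons:
  assumes "is_path E ys y z" "(x, y) \<in> E" "x \<notin> set ys"
  shows "is_path E (x # ys) x z"
  using assms by (auto simp: is_path_def successively_Cons)

lemma is_path_rev: "sym E \<Longrightarrow> is_path E xs x y \<Longrightarrow> is_path E (rev xs) y x"
  unfolding is_path_def
  by (auto simp: hd_rev last_rev elim!: successively_mono dest: symD)

lemma is_path_single: "is_path E [x] x x"
  by (simp add: is_path_def)

lemma is_path_ends: "is_path E xs x y \<Longrightarrow> x \<in> set xs \<and> y \<in> set xs"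
  by (auto simp: is_path_def)

lemma is_path_ends_neq: "is_path E xs x y \<Longrightarrow> even (length xs) \<Longrightarrow> x \<noteq> y"
  by (cases xs) (auto simp: is_path_def split: if_splits)

text \<open>In the application \<open>m\<close> is \<open>2 * p + 1\<close> and \<open>d\<close> is
  the minimum degree, so \<open>card_V\<close> is the degree condition without division.\<close>

locale dense_graph =
  fixes V :: "'a set" and E :: "'a rel" and m k d :: nat
  assumes finite_V: "finite V" and E_subset: "E \<subseteq> V \<times> V" and sym: "sym E"
    and irrefl: "\<And>x. (x, x) \<notin> E"
    and degree: "\<And>x. x \<in> V \<Longrightarrow> d \<le> card (E `` {x})"
    and card_V: "card V \<le> 2 * m * d" and d_large: "m * (2 * m + 1) * (2 * m * k) < d"
    and m_ge: "3 \<le> m" and k_ge: "2 * m \<le> Suc k"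
    and no_cycle: "\<And>cs. length cs = 2 * k + 1 \<Longrightarrow> is_path E cs (hd cs) (last cs) \<Longrightarrow>
      (last cs, hd cs) \<notin> E"
begin

abbreviation N :: "'a \<Rightarrow> 'a set" where
  "N x \<equiv> E `` {x}"

definition linked :: "'a \<Rightarrow> 'a \<Rightarrow> bool" where
  "linked x y \<longleftrightarrow> 2 * m * k \<le> card (N x \<inter> N y)"

lemma linked_sym: "linked x y \<Longrightarrow> linked y x"
  by (simp add: linked_def Int_commute)

lemma N_sym: "y \<in> N x \<longleftrightarrow> x \<in> N y"
  using sym by (auto dest: symD)

lemma N_subset: "N x \<subseteq> V"
  using E_subset by auto

lemma finite_N: "finite (N x)"
  using N_subset finite_V finite_subset by blast

text \<open>By Bonferroni, \<open>2 * m + 1\<close> pairwise unlinked vertices would together have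
  at least \<open>(2 * m + 1) * d - m * (2 * m + 1) * (2 * m * k)\<close> neighbours, which exceeds
  \<open>2 * m * d\<close> by \<open>d_large\<close>.\<close>

lemma linked_pair_exists:
  assumes "I \<subseteq> V" "card I = 2 * m + 1"
  shows "\<not> pairwise (\<lambda>x y. \<not> linked x y) I"
proof
  let ?K = "2 * m * k"
  assume "pairwise (\<lambda>x y. \<not> linked x y) I"
  then have "pairwise (\<lambda>x y. card (N x \<inter> N y) \<le> ?K) I"
    by (auto simp: pairwise_def linked_def not_le intro: less_imp_le)
  moreover have "finite I" using assms finite_V finite_subset by blast
  moreover have "finite (N x) \<and> d \<le> card (N x)" if "x \<in> I" for x
    using that assms finite_N degree by blast
  ultimately have "2 * card I * d \<le> 2 * card (\<Union>x\<in>I. N x) + card I * (card I - 1) * ?K"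
    using sum_card_le_card_UN[of I N d ?K] by blast
  moreover have "card (\<Union>x\<in>I. N x) \<le> card V"
    using N_subset finite_V by (intro card_mono) auto
  ultimately have "2 * (2 * m + 1) * d \<le> 4 * m * d + (2 * m + 1) * (2 * m) * ?K"
    using card_V assms(2) by simp
  then have "d \<le> m * (2 * m + 1) * ?K"
    by (simp add: algebra_simps)
  then show False using d_large by simp
qed

section \<open>Expanding paths of linked vertices\<close>

lemma linked_fresh:
  assumes "linked x y" "finite F" "card F < 2 * m * k"
  obtains z where "(x, z) \<in> E" "(z, y) \<in> E" "z \<notin> F"
proof -
  have "\<not> N x \<inter> N y \<subseteq> F"
    using assms card_mono[of F "N x \<inter> N y"] by (auto simp: linked_def)
  then show thesis using that sym by (auto dest: symD)
qed

lemma six_k: "6 * k \<le> 2 * m * k"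
  using m_ge by simp

lemma k_ge_5: "5 \<le> k"
  using m_ge k_ge by simp

text \<open>A common neighbour is inserted between consecutive vertices of \<open>ys\<close>. The
  inserted vertices must avoid \<open>F\<close>, which contains \<open>ys\<close> itself; the size
  bound leaves room for the expanded path as well.\<close>

lemma path_through_linked:
  assumes "ys \<noteq> []" "distinct ys" "successively linked ys" "set ys \<subseteq> F" "finite F"
    and "card F + 2 * length ys \<le> 2 * m * k"
  shows "\<exists>zs. length zs = 2 * length ys - 1 \<and> is_path E zs (hd ys) (last ys) \<and>
    set zs \<inter> F \<subseteq> set ys"
  using assms
proof (induction ys rule: list_nonempty_induct)
  case (single y)
  then show ?case by (intro exI[of _ "[y]"]) (auto simp: is_path_single)
next
  case (cons y ys)
  then obtain zs where zs: "length zs = 2 * length ys - 1" "is_path E zs (hd ys) (last ys)"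
      "set zs \<inter> F \<subseteq> set ys"
    by (auto simp: successively_Cons)
  have "card (F \<union> set zs) \<le> card F + length zs"
    using card_Un_le[of F "set zs"] card_length[of zs] by linarith
  also have "\<dots> < 2 * m * k" using cons zs(1) by simp
  finally obtain z where z: "(y, z) \<in> E" "(z, hd ys) \<in> E" "z \<notin> F \<union> set zs"
    using linked_fresh[of y "hd ys" "F \<union> set zs"] cons by (auto simp: successively_Cons)
  have "is_path E (y # z # zs) y (last ys)"
    using z zs cons by (intro is_path_Cons[OF is_path_Cons]) auto
  moreover have "length (y # z # zs) = 2 * length (y # ys) - 1"
    using zs(1) cons(1) by (cases ys) auto
  moreover have "set (y # z # zs) \<inter> F \<subseteq> set (y # ys)" using z zs by auto
  ultimately show ?case using cons(1) by (metis last_ConsR list.sel(1))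
qed

text \<open>A long path of linked vertices inside \<open>N x \<inter> N y\<close> expands to paths from \<open>x\<close> to \<open>y\<close> of
  every small even length, which would close the path \<open>xs\<close> to a cycle of length \<open>2 * k + 1\<close>.\<close>

lemma no_odd_path_if_linked:
  assumes "linked x y" "is_path E xs x y" "even (length xs)" "length xs \<le> 2 * k"
  shows False
proof -
  obtain h where h: "length xs = 2 * h" using assms(3) by blast
  have "h \<noteq> 0" using assms(2) h by (cases xs) (auto simp: is_path_def)
  have "h \<le> k" using assms(4) h by simp
  have xy: "x \<noteq> y" using is_path_ends_neq assms by metis
  have c: "card (set xs - {x, y}) = 2 * h - 2"
    using assms(2) h xy is_path_ends[OF assms(2)]
    by (simp add: card_Diff_subset distinct_card is_path_def)
  \<comment> \<open>The inner vertices of \<open>xs\<close> are removed; \<open>x\<close> and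
    \<open>y\<close> are absent anyway, since there are no loops.\<close>
  define S where "S = N x \<inter> N y - (set xs - {x, y})"
  have S_xs: "S \<inter> set xs = {}" using irrefl by (auto simp: S_def)
  have "card (N x \<inter> N y) - card (set xs - {x, y}) \<le> card S"
    unfolding S_def by (rule diff_card_le_card_Diff) simp
  then have "2 * m * k \<le> card S + (2 * h - 2)"
    using assms(1) c by (simp add: linked_def)
  moreover have "2 * m * (k - h) + 6 * h \<le> 2 * m * k"
  proof -
    have "2 * m * k = 2 * m * (k - h) + 2 * m * h"
      using \<open>h \<le> k\<close> by (metis add.commute add_mult_distrib2 le_add_diff_inverse)
    then show ?thesis using m_ge by simp
  qed
  \<comment> \<open>A linked path on \<open>k - h + 1\<close> vertices expands to
    \<open>2 * (k - h) + 1\<close> vertices, which together with the \<open>2 * h\<close> vertices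
    of \<open>xs\<close> make \<open>2 * k + 1\<close>.\<close>
  ultimately have "2 * m * (Suc (k - h) - 1) < card S" using \<open>h \<noteq> 0\<close> by simp
  moreover have "finite S" "S \<subseteq> V" using finite_N N_subset by (auto simp: S_def)
  moreover have "\<not> (\<exists>I \<subseteq> S. card I = Suc (2 * m) \<and> pairwise (\<lambda>x y. \<not> linked x y) I)"
    using linked_pair_exists \<open>S \<subseteq> V\<close> by (metis Suc_eq_plus1 subset_trans)
  ultimately obtain ys where ys: "distinct ys" "set ys \<subseteq> S" "length ys = Suc (k - h)"
      "successively linked ys"
    using path_or_independent_set[of S "2 * m" "Suc (k - h)" linked] linked_sym by blast
  let ?F = "set xs \<union> set ys"
  have "card ?F \<le> 2 * h + Suc (k - h)"
    using card_Un_le[of "set xs" "set ys"] card_length[of xs] card_length[of ys] h ys(3) by simp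
  then have "card ?F + 2 * length ys \<le> 6 * k"
    using ys(3) \<open>h \<le> k\<close> \<open>h \<noteq> 0\<close> k_ge_5 by simp
  then have "card ?F + 2 * length ys \<le> 2 * m * k" using six_k by (rule le_trans)
  then obtain zs where zs: "length zs = 2 * length ys - 1" "is_path E zs (hd ys) (last ys)"
      "set zs \<inter> ?F \<subseteq> set ys"
    using path_through_linked[of ys ?F] ys by fastforce
  have ends: "hd ys \<in> S" "last ys \<in> S" using ys by (cases ys; fastforce)+
  then have "(y, last ys) \<in> E" "(hd ys, x) \<in> E" using sym by (auto simp: S_def dest: symD)
  moreover have "set xs \<inter> set zs = {}" using zs(3) ys(2) S_xs by blast
  ultimately have path: "is_path E (xs @ rev zs) x (hd ys)"
    using is_path_append[OF assms(2) is_path_rev[OF sym zs(2)]] by simp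
  have "length (xs @ rev zs) = 2 * k + 1"
    using h zs(1) ys(3) \<open>h \<le> k\<close> by simp
  then show False
    using no_cycle path \<open>(hd ys, x) \<in> E\<close> by (metis is_path_def)
qed

end

section \<open>The classes around an odd cycle\<close>

text \<open>Chords are still allowed here. The bound \<open>l < 2 * k\<close> keeps paths along the
  cycle short enough for \<open>no_odd_path_if_linked\<close>, and \<open>l \<le> 4 * m\<close>
  serves the counting.\<close>

locale dense_graph_with_odd_cycle = dense_graph +
  fixes v :: "nat \<Rightarrow> 'a" and l :: nat
  assumes odd_l: "odd l" and l_ge: "3 \<le> l" and l_less: "l < 2 * k" and l_le: "l \<le> 4 * m"
    and v_inj: "inj_on v {..<l}"
    and cycle_step: "\<And>i. i < l \<Longrightarrow> (v i, v (Suc i mod l)) \<in> E"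
begin

abbreviation C :: "'a set" where
  "C \<equiv> v ` {..<l}"

section \<open>Arcs of the cycle and their parity\<close>

lemma v_eq_iff: "i < l \<Longrightarrow> j < l \<Longrightarrow> v i = v j \<longleftrightarrow> i = j"
  using v_inj by (auto simp: inj_on_def)

lemma C_subset: "C \<subseteq> V"
  using cycle_step E_subset by blast

lemma segment_is_path:
  assumes "i < j" "j \<le> l"
  shows "is_path E (map v [i..<j]) (v i) (v (j - 1))"
proof -
  have "successively (\<lambda>a b. (v a, v b) \<in> E) [i..<j]"
    using assms
  proof (induction j)
    case (Suc j)
    show ?case
    proof (cases "i = j")
      case False
      moreover have "(v (j - 1), v j) \<in> E"
        using cycle_step[of "j - 1"] Suc.prems False by simp
      ultimately show ?thesis using Suc by (simp add: successively_append_iff)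
    qed simp
  qed simp
  moreover have "inj_on v {i..<j}" using v_inj by (rule inj_on_subset) (use assms in auto)
  ultimately show ?thesis
    using assms by (simp add: is_path_def successively_map distinct_map hd_map last_map)
qed

text \<open>The two arcs share their ends, so their numbers of vertices add up to
  \<open>l + 2\<close>, which is odd. Hence one of them has the parity requested by
  \<open>b\<close>.\<close>

lemma arc_less:
  assumes "i < j" "j < l"
  shows "\<exists>xs. is_path E xs (v i) (v j) \<and> set xs \<subseteq> C \<and> length xs \<le> l \<and> (even (length xs) \<longleftrightarrow> b)"
proof (cases "even (Suc j - i) \<longleftrightarrow> b")
  case True
  then show ?thesis
    using segment_is_path[of i "Suc j"] assms by (intro exI[of _ "map v [i..<Suc j]"]) auto
next
  case False
  let ?xs = "map v [j..<l]" and ?ys = "map v [0..<Suc i]"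
  have "is_path E ?xs (v j) (v (l - 1))" "is_path E ?ys (v 0) (v i)"
    using segment_is_path[of j l] segment_is_path[of 0 "Suc i"] assms by simp_all
  moreover have "(v (l - 1), v 0) \<in> E" using cycle_step[of "l - 1"] l_ge by simp
  moreover have "set ?xs \<inter> set ?ys = {}" using assms by (auto simp: v_eq_iff)
  ultimately have "is_path E (?xs @ ?ys) (v j) (v i)" by (rule is_path_append)
  then have "is_path E (rev (?xs @ ?ys)) (v i) (v j)" by (rule is_path_rev[OF sym])
  moreover have "length (rev (?xs @ ?ys)) = l - j + Suc i" by simp
  moreover have "l - j + Suc i \<le> l" using assms by simp
  moreover have "even (l - j + Suc i) \<longleftrightarrow> b"
  proof -
    have "l - j + Suc i + (Suc j - i) = l + 2" using assms by simp
    then have "odd (l - j + Suc i + (Suc j - i))" using odd_l by simp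
    then show ?thesis using False by (simp only: even_add) blast
  qed
  moreover have "set (rev (?xs @ ?ys)) \<subseteq> C" using assms by auto
  ultimately show ?thesis by metis
qed

lemma arc:
  assumes "i < l" "j < l" "i \<noteq> j"
  shows "\<exists>xs. is_path E xs (v i) (v j) \<and> set xs \<subseteq> C \<and> length xs \<le> l \<and> (even (length xs) \<longleftrightarrow> b)"
proof (cases "i < j")
  case False
  then obtain xs where "is_path E xs (v j) (v i) \<and> set xs \<subseteq> C \<and> length xs \<le> l \<and>
      (even (length xs) \<longleftrightarrow> b)"
    using arc_less[of j i b] assms by auto
  then show ?thesis using is_path_rev[OF sym] by (metis length_rev set_rev)
qed (use arc_less assms in simp)

lemma v_not_linked:
  assumes "i < l" "j < l" "i \<noteq> j"
  shows "\<not> linked (v i) (v j)"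
  using arc[OF assms, of True] no_odd_path_if_linked l_less by (metis le_trans less_imp_le)

text \<open>The two terms are what \<open>private_neighbour_exists\<close> discards: the cycle
  itself and the vertices shared with another cycle vertex.\<close>

lemma cycle_degree_large: "l + l * (2 * m * k) < d"
proof -
  have "3 * (m * m * k) \<le> m * (m * m * k)" using m_ge by (rule mult_le_mono1)
  moreover have "3 * (m * k) \<le> m * (m * k)" using m_ge by (rule mult_le_mono1)
  moreover have "m * 1 \<le> m * k" using k_ge_5 by (intro mult_le_mono) auto
  moreover have "m * (2 * m + 1) * (2 * m * k) = 4 * (m * (m * m * k)) + 2 * (m * m * k)"
    and "4 * m * (2 * m * k) = 8 * (m * m * k)" and "m * (m * k) = m * m * k"
    by (simp_all add: algebra_simps)
  ultimately have "4 * m + 4 * m * (2 * m * k) \<le> m * (2 * m + 1) * (2 * m * k)"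
    by linarith
  moreover have "l * (2 * m * k) \<le> 4 * m * (2 * m * k)" using l_le by (intro mult_le_mono) auto
  ultimately show ?thesis using l_le d_large by linarith
qed

text \<open>Otherwise every neighbour of \<open>v i\<close> lies on the cycle or is shared with
  another \<open>v j\<close>. Distinct cycle vertices are not linked, so this leaves fewer than
  \<open>d\<close> neighbours.\<close>

lemma private_neighbour_exists:
  assumes "i < l"
  shows "\<exists>x. (v i, x) \<in> E \<and> x \<notin> C \<and> (\<forall>j<l. j \<noteq> i \<longrightarrow> (v j, x) \<notin> E)"
proof (rule ccontr)
  assume none: "\<not> ?thesis"
  let ?U = "\<Union>j\<in>{..<l} - {i}. N (v i) \<inter> N (v j)"
  have "N (v i) \<subseteq> C \<union> ?U" using none by blast
  moreover have "finite (C \<union> ?U)" using finite_N by simp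
  ultimately have "card (N (v i)) \<le> card (C \<union> ?U)" by (rule card_mono[rotated])
  also have "\<dots> \<le> card C + card ?U" by (rule card_Un_le)
  also have "card ?U \<le> (\<Sum>j\<in>{..<l} - {i}. card (N (v i) \<inter> N (v j)))"
    by (rule card_UN_le) simp
  also have "\<dots> \<le> (\<Sum>j\<in>{..<l} - {i}. 2 * m * k)"
    using v_not_linked assms by (intro sum_mono) (auto simp: linked_def not_le intro: less_imp_le)
  also have "\<dots> \<le> l * (2 * m * k)" using assms by simp
  also have "card C = l" using v_inj by (simp add: card_image)
  finally have "card (N (v i)) \<le> l + l * (2 * m * k)" by simp
  moreover have "d \<le> card (N (v i))" using degree C_subset assms by blast
  ultimately show False using cycle_degree_large by simp
qed

section \<open>The \<open>2 * l\<close> representatives\<close>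

definition u :: "nat \<Rightarrow> 'a" where
  "u i = (SOME x. (v i, x) \<in> E \<and> x \<notin> C \<and> (\<forall>j<l. j \<noteq> i \<longrightarrow> (v j, x) \<notin> E))"

lemma u:
  assumes "i < l"
  shows "(v i, u i) \<in> E" "u i \<notin> C" "j < l \<Longrightarrow> (v j, u i) \<in> E \<Longrightarrow> j = i"
proof -
  have "(v i, u i) \<in> E \<and> u i \<notin> C \<and> (\<forall>j<l. j \<noteq> i \<longrightarrow> (v j, u i) \<notin> E)"
    unfolding u_def by (rule someI_ex[OF private_neighbour_exists[OF assms]])
  then show "(v i, u i) \<in> E" "u i \<notin> C" "j < l \<Longrightarrow> (v j, u i) \<in> E \<Longrightarrow> j = i"
    by auto
qed

lemma u_neq_v: "i < l \<Longrightarrow> j < l \<Longrightarrow> u i \<noteq> v j" "i < l \<Longrightarrow> j < l \<Longrightarrow> v j \<noteq> u i"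
  using u(2)[of i] by (metis imageI lessThan_iff)+

lemma u_eq_iff: "i < l \<Longrightarrow> j < l \<Longrightarrow> u i = u j \<longleftrightarrow> i = j"
  using u(1)[of i] u(3)[of j i] by metis

text \<open>The flag matches the side in \<open>BC\<close>: the cycle vertices, which become the
  selected ones, carry \<open>False\<close>.\<close>

fun w :: "nat \<times> bool \<Rightarrow> 'a" where
  "w (i, s) = (if s then u i else v i)"

definition J :: "(nat \<times> bool) set" where
  "J = {..<l} \<times> UNIV"

lemma w_inj: "inj_on w J"
  by (auto simp: inj_on_def J_def u_eq_iff v_eq_iff u_neq_v split: if_splits)

text \<open>An arc of the cycle is prolonged by \<open>u i\<close>, by \<open>u j\<close>, by both
  or by neither.\<close>

lemma w_path:
  assumes "i < l" "j < l" "i \<noteq> j"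
  shows "\<exists>xs. is_path E xs (w (i, s)) (w (j, s')) \<and> set xs \<subseteq> w ` J \<and> length xs \<le> l + 2 \<and>
    (even (length xs) \<longleftrightarrow> b)"
proof -
  \<comment> \<open>Prolonging at exactly one end changes the parity, so the arc is then taken with
    the opposite one.\<close>
  obtain xs where xs: "is_path E xs (v i) (v j)" "set xs \<subseteq> C" "length xs \<le> l"
      "even (length xs) \<longleftrightarrow> (if s = s' then b else \<not> b)"
    using arc[OF assms] by metis
  have C: "C \<subseteq> w ` J" "u i \<in> w ` J" "u j \<in> w ` J"
    using assms by (force simp: J_def)+
  define ys where "ys = (if s then u i # xs else xs)"
  have u_sym: "(u i, v i) \<in> E" using u(1) assms sym by (auto dest: symD)
  have ys: "is_path E ys (w (i, s)) (v j)" "set ys \<subseteq> insert (u i) C"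
      "length ys = length xs + (if s then 1 else 0)"
    using xs u(2) assms u_sym by (auto simp: ys_def intro!: is_path_Cons[OF xs(1)])
  define zs where "zs = (if s' then ys @ [u j] else ys)"
  have "is_path E zs (w (i, s)) (w (j, s'))"
  proof (cases s')
    case True
    have "u j \<notin> set ys" using ys(2) u(2) assms u_eq_iff by blast
    then show ?thesis
      using True is_path_append[OF ys(1) is_path_single u(1)] assms by (simp add: zs_def)
  qed (use ys in \<open>simp add: zs_def\<close>)
  moreover have "set zs \<subseteq> w ` J" 
  proof -
    have "set zs \<subseteq> insert (u j) (set ys)" by (auto simp: zs_def)
    then show ?thesis using ys(2) C by (meson insert_subset subset_trans)
  qed
  moreover have "length zs \<le> l + 2" using ys(3) xs(3) by (simp add: zs_def)
  moreover have "even (length zs) \<longleftrightarrow> b" using xs(4) ys(3) by (auto simp: zs_def)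
  ultimately show ?thesis by blast
qed

text \<open>Two representatives with the same index are adjacent, which is a path on two vertices;
  any others are joined by \<open>w_path\<close> with an even number of vertices.\<close>

lemma w_not_linked: "pairwise (\<lambda>x y. \<not> linked x y) (w ` J)"
proof -
  have "\<not> linked (w (i, s)) (w (j, s'))" if ij: "i < l" "j < l" "(i, s) \<noteq> (j, s')" for i j s s'
  proof
    assume linked: "linked (w (i, s)) (w (j, s'))"
    show False
    proof (cases "i = j")
      case True
      have edge: "(w (i, s), w (j, s')) \<in> E"
        using u(1) ij True sym by (auto dest: symD)
      then have "is_path E [w (i, s), w (j, s')] (w (i, s)) (w (j, s'))"
        using irrefl by (metis empty_iff empty_set is_path_Cons is_path_single set_ConsD)
      then show False using no_odd_path_if_linked[OF linked] k_ge_5 by fastforce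
    next
      case False
      then obtain xs where xs: "is_path E xs (w (i, s)) (w (j, s'))" "length xs \<le> l + 2"
          "even (length xs)"
        using w_path[OF ij(1,2) False, of s s' True] by blast
      \<comment> \<open>As \<open>l + 2\<close> is odd, the path has at most \<open>l + 1\<close>,
        hence at most \<open>2 * k\<close> vertices.\<close>
      have "length xs \<noteq> l + 2" using xs(3) odd_l by auto
      then show False using no_odd_path_if_linked[OF linked xs(1,3)] xs(2) l_less by simp
    qed
  qed
  then have "\<not> linked (w a) (w b)" if "a \<in> J" "b \<in> J" "a \<noteq> b" for a b
    using that by (cases a; cases b) (auto simp: J_def simp del: w.simps)
  then show ?thesis by (auto simp: pairwise_def simp del: w.simps)
qed

lemma w_J_subset: "w ` J \<subseteq> V"
proof -
  have "u i \<in> V" "v i \<in> V" if "i < l" for i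
    using u(1)[OF that] C_subset E_subset that by blast+
  then show ?thesis by (auto simp: J_def)
qed

lemma card_w_J: "card (w ` J) = 2 * l"
  using w_inj by (simp add: card_image J_def card_cartesian_product)

lemma l_le_m: "l \<le> m"
proof (rule ccontr)
  assume "\<not> l \<le> m"
  then have "2 * m + 1 \<le> card (w ` J)" using card_w_J by simp
  then obtain I where "I \<subseteq> w ` J" "card I = 2 * m + 1"
    by (meson obtain_subset_with_card_n)
  then show False
    using linked_pair_exists w_not_linked w_J_subset by (metis pairwise_subset subset_trans)
qed

end

section \<open>The extremal structure\<close>

text \<open>Prescribing the value \<open>0\<close> will put \<open>v i\<close> at the position that
  \<open>BC\<close> reserves for a selected vertex.\<close>

lemma bij_betw_lessThan_pointed:
  assumes "finite A" "x \<in> A"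
  shows "\<exists>g. bij_betw g A {..<card A} \<and> g x = (0 :: nat)"
proof -
  have "card (A - {x}) = card {1..<card A}" using assms by simp
  then obtain h where h: "bij_betw h (A - {x}) {1..<card A}"
    using assms by (meson finite_Diff finite_atLeastLessThan finite_same_card_bij)
  have "bij_betw (h(x := 0)) (A - {x}) {1..<card A}"
    using h by (subst bij_betw_cong[of _ _ h]) auto
  then have "bij_betw (h(x := 0)) (A - {x} \<union> {x}) ({1..<card A} \<union> {0})"
    using notIn_Un_bij_betw[of x "A - {x}" "h(x := 0)" "{1..<card A}"] by simp
  moreover have "A - {x} \<union> {x} = A" using assms by auto
  moreover have "card A > 0" using assms by (auto simp: card_gt_0_iff)
  then have "{1..<card A} \<union> {0} = {..<card A}" by auto
  ultimately show ?thesis by (intro exI[of _ "h(x := 0)"]) simp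
qed

text \<open>The bound \<open>m \<le> l\<close> will come from the exclusion of all odd cycles of
  length below \<open>m\<close>, and \<open>chordless\<close> from the choice of a shortest odd
  closed walk.\<close>

locale extremal_graph = dense_graph_with_odd_cycle +
  assumes m_le: "m \<le> l"
    and chordless: "\<And>i j. i < l \<Longrightarrow> j < l \<Longrightarrow> (v i, v j) \<in> E \<Longrightarrow> j = Suc i mod l \<or> i = Suc j mod l"
begin

section \<open>Assigning every vertex to a class\<close>

lemma l_eq_m: "l = m"
  using m_le l_le_m by simp

lemma finite_W: "finite (w ` J)"
  using w_J_subset finite_V finite_subset by blast

lemma w_in_W: "i < l \<Longrightarrow> u i \<in> w ` J \<and> v i \<in> w ` J"
  by (force simp: J_def)

text \<open>Adding \<open>x\<close> to the \<open>2 * m\<close> representatives gives a set with a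
  linked pair, which must involve \<open>x\<close>.\<close>

lemma class_exists:
  assumes "x \<in> V"
  shows "\<exists>a. a \<in> J \<and> (x = w a \<or> x \<notin> w ` J \<and> linked x (w a))"
proof (cases "x \<in> w ` J")
  case False
  then have "card (insert x (w ` J)) = 2 * m + 1"
    using card_w_J finite_W l_eq_m by simp
  then have "\<not> pairwise (\<lambda>x y. \<not> linked x y) (insert x (w ` J))"
    using linked_pair_exists assms w_J_subset by (metis insert_subset)
  then have "\<exists>y \<in> w ` J. linked x y"
    using w_not_linked linked_sym unfolding pairwise_insert by blast
  then show ?thesis using False by blast
qed blast

definition c :: "'a \<Rightarrow> nat \<times> bool" where
  "c x = (SOME a. a \<in> J \<and> (x = w a \<or> x \<notin> w ` J \<and> linked x (w a)))"

lemma c: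
  assumes "x \<in> V"
  shows "c x \<in> J" "x = w (c x) \<or> x \<notin> w ` J \<and> linked x (w (c x))"
proof -
  have "c x \<in> J \<and> (x = w (c x) \<or> x \<notin> w ` J \<and> linked x (w (c x)))"
    unfolding c_def by (rule someI_ex[OF class_exists[OF assms]])
  then show "c x \<in> J" "x = w (c x) \<or> x \<notin> w ` J \<and> linked x (w (c x))" by auto
qed

lemma c_w: "a \<in> J \<Longrightarrow> c (w a) = a"
  using c[of "w a"] w_J_subset inj_onD[OF w_inj] by (metis image_eqI subsetD)

lemma c_v: "i < l \<Longrightarrow> c (v i) = (i, False)"
  using c_w[of "(i, False)"] by (simp add: J_def)

lemma c_u: "i < l \<Longrightarrow> c (u i) = (i, True)"
  using c_w[of "(i, True)"] by (simp add: J_def)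

text \<open>Extending \<open>xs\<close> to start at \<open>x\<close> gives a path on an even number
  of vertices to \<open>w (c x)\<close>, to which \<open>x\<close> is linked. Only \<open>x\<close>
  is prepended if \<open>y\<close> is a representative; otherwise \<open>x\<close>, \<open>y\<close>
  and a common neighbour \<open>z\<close> of \<open>y\<close> and \<open>w (c y)\<close>
  are.\<close>

lemma no_even_path_between_classes:
  assumes "(x, y) \<in> E" "x \<notin> w ` J" "is_path E xs (w (c y)) (w (c x))" "set xs \<subseteq> w ` J"
    and "odd (length xs)" "length xs \<le> l + 2"
  shows False
proof -
  have V: "x \<in> V" "y \<in> V" using assms(1) E_subset by auto
  have "c x \<in> J" using c V by blast
  then have linked: "linked x (w (c x))" using c(2)[OF V(1)] assms(2) by blast
  have len: "l + 5 \<le> 2 * k" using l_eq_m m_ge k_ge by simp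
  show False
  proof (cases "y = w (c y)")
    case True
    then have "is_path E (x # xs) x (w (c x))"
      using assms by (intro is_path_Cons[OF assms(3)]) auto
    then show False using no_odd_path_if_linked[OF linked] assms len by fastforce
  next
    case False
    then have y: "y \<notin> w ` J" "linked y (w (c y))" using c(2)[OF V(2)] by auto
    let ?F = "insert x (w ` J)"
    have "card ?F \<le> 2 * l + 1" using card_w_J finite_W assms(2) by simp
    then have "card ?F < 2 * m * k" using six_k len by linarith
    then obtain z where z: "(y, z) \<in> E" "(z, w (c y)) \<in> E" "z \<notin> ?F"
      using linked_fresh[OF y(2), of ?F] finite_W by blast
    have "x \<noteq> y" "y \<noteq> z" using assms(1) z(1) irrefl by auto
    then have "is_path E (x # y # z # xs) x (w (c x))"
      using assms y z by (intro is_path_Cons[OF is_path_Cons[OF is_path_Cons[OF assms(3)]]]) auto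
    then show False using no_odd_path_if_linked[OF linked] assms len by fastforce
  qed
qed

text \<open>If this fails, the classes are equal or have different indices. Either way their
  representatives are joined by a path on an odd number of vertices, a single vertex in the first
  case.\<close>

lemma edge_within_block_if_left:
  assumes "(x, y) \<in> E" "x \<notin> w ` J"
  shows "fst (c x) = fst (c y) \<and> snd (c x) \<noteq> snd (c y)"
proof (rule ccontr)
  assume no: "\<not> ?thesis"
  have J: "c x \<in> J" "c y \<in> J" using assms(1) E_subset c by blast+
  have "\<exists>xs. is_path E xs (w (c y)) (w (c x)) \<and> set xs \<subseteq> w ` J \<and> length xs \<le> l + 2 \<and>
      (even (length xs) \<longleftrightarrow> False)"
  proof (cases "c x = c y")
    case True
    then show ?thesis
      using J by (intro exI[of _ "[w (c x)]"]) (simp add: is_path_single)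
  next
    case False
    then have "fst (c y) < l" "fst (c x) < l" "fst (c y) \<noteq> fst (c x)"
      using no J by (auto simp: J_def prod_eq_iff)
    from w_path[OF this, of "snd (c y)" "snd (c x)" False] show ?thesis
      by (simp only: prod.collapse)
  qed
  then show False using no_even_path_between_classes[OF assms] by blast
qed

lemma edge_within_block:
  assumes "(x, y) \<in> E" "x \<notin> w ` J \<or> y \<notin> w ` J"
  shows "fst (c x) = fst (c y) \<and> snd (c x) \<noteq> snd (c y)"
  using edge_within_block_if_left[of x y] edge_within_block_if_left[of y x] assms symD[OF sym]
  by metis

lemma neighbour_outside_W:
  assumes "x \<in> V"
  obtains y where "(x, y) \<in> E" "y \<notin> w ` J"
proof -
  have "2 * l \<le> l * (2 * m * k)" using six_k k_ge_5 by simp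
  then have "card (w ` J) < card (N x)"
    using degree[OF assms] cycle_degree_large card_w_J by linarith
  then have "\<not> N x \<subseteq> w ` J" using card_mono[OF finite_W] by (meson not_le)
  then show thesis using that by blast
qed

text \<open>Some neighbour \<open>y\<close> of \<open>v i\<close> lies in the class of
  \<open>u i\<close> and so is linked to \<open>u i\<close>. The edge would give a path from
  \<open>y\<close> over \<open>v i\<close>, along the cycle to \<open>v j\<close>, and on to
  \<open>u j\<close> and \<open>u i\<close>, with an even number of vertices.\<close>

lemma u_not_adjacent:
  assumes "i < l" "j < l"
  shows "(u i, u j) \<notin> E"
proof
  assume edge: "(u i, u j) \<in> E"
  then have "i \<noteq> j" using irrefl by metis
  obtain y where y: "(v i, y) \<in> E" "y \<notin> w ` J"
    using neighbour_outside_W C_subset assms(1) by blast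
  then have "c y = (i, True)"
    using edge_within_block[OF y(1)] c_v[OF assms(1)] by (simp add: prod_eq_iff)
  moreover have "y \<in> V" using y E_subset by blast
  ultimately have linked: "linked y (u i)" using c(2)[of y] y(2) w_in_W[OF assms(1)] by auto
  obtain xs where xs: "is_path E xs (v i) (v j)" "set xs \<subseteq> C" "length xs \<le> l" "odd (length xs)"
    using arc[OF assms \<open>i \<noteq> j\<close>, of False] by blast
  have C: "C \<subseteq> w ` J" using w_in_W by blast
  have "(u j, u i) \<in> E" "(y, v i) \<in> E" using edge y sym by (auto dest: symD)
  then have "is_path E [u j, u i] (u j) (u i)"
    using \<open>i \<noteq> j\<close> assms u_eq_iff by (intro is_path_Cons[OF is_path_single]) auto
  then have "is_path E (xs @ [u j, u i]) (v i) (u i)"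
    using xs u(1,2) assms by (intro is_path_append[OF xs(1)]) auto
  then have "is_path E (y # xs @ [u j, u i]) y (u i)"
    using xs C y(2) \<open>(y, v i) \<in> E\<close> w_in_W assms by (intro is_path_Cons) auto
  moreover have "length (y # xs @ [u j, u i]) \<le> 2 * k"
    using xs(3) l_eq_m m_ge k_ge by simp
  ultimately show False using no_odd_path_if_linked[OF linked] xs(4) by fastforce
qed

text \<open>By the choice of the \<open>u i\<close> and by \<open>u_not_adjacent\<close>, an edge
  between representatives joins some \<open>v i\<close> to \<open>u i\<close> or joins two cycle
  vertices.\<close>

lemma edge_cases:
  assumes "(x, y) \<in> E"
  shows "fst (c x) = fst (c y) \<and> snd (c x) \<noteq> snd (c y) \<or> x \<in> C \<and> y \<in> C"
proof (cases "x \<in> w ` J \<and> y \<in> w ` J")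
  case True
  then obtain i s j s' where xy: "x = w (i, s)" "y = w (j, s')" "i < l" "j < l"
    by (auto simp: J_def simp del: w.simps)
  then have c: "c x = (i, s)" "c y = (j, s')" using c_w by (auto simp: J_def simp del: w.simps)
  have "(y, x) \<in> E" using assms sym by (auto dest: symD)
  then show ?thesis
    using assms xy c u_not_adjacent u(3)[of i j] u(3)[of j i] by (cases s; cases s') auto
qed (use edge_within_block[OF assms] in blast)

section \<open>Sizes of classes and neighbourhoods\<close>

definition cls :: "nat \<times> bool \<Rightarrow> 'a set" where
  "cls a = {x \<in> V. c x = a}"

lemma N_subset_cls: "x \<in> V \<Longrightarrow> x \<notin> C \<Longrightarrow> N x \<subseteq> cls (fst (c x), \<not> snd (c x))"
  using edge_cases N_subset by (fastforce simp: cls_def prod_eq_iff)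

text \<open>The neighbourhood of any vertex off the cycle in the opposite class lies in
  \<open>cls a\<close>, so it suffices to find such a vertex.\<close>

lemma card_cls_ge:
  assumes "a \<in> J"
  shows "d \<le> card (cls a)"
proof -
  obtain i s where a: "a = (i, s)" "i < l" using assms by (auto simp: J_def)
  have u: "u i \<in> V" "u i \<notin> C" using u(1,2) a E_subset by blast+
  have "\<exists>x \<in> V. x \<notin> C \<and> c x = (i, \<not> s)"
  proof (cases s)
    case True
    \<comment> \<open>The opposite representative \<open>v i\<close> lies on the cycle, so a
      neighbour of \<open>u i\<close> outside the representatives is taken instead.\<close>
    obtain y where y: "(u i, y) \<in> E" "y \<notin> w ` J" using neighbour_outside_W u by blast
    then have "c y = (i, False)"
      using edge_within_block[OF y(1)] c_u a by (simp add: prod_eq_iff)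
    moreover have "y \<in> V" "y \<notin> C" using y E_subset w_in_W by blast+
    ultimately show ?thesis using True by auto
  next
    case False
    then show ?thesis using u c_u a by auto
  qed
  then obtain x where x: "x \<in> V" "x \<notin> C" "c x = (i, \<not> s)" by blast
  then have "N x \<subseteq> cls a" using N_subset_cls a by fastforce
  moreover have "finite (cls a)" using finite_V by (simp add: cls_def)
  ultimately show ?thesis using degree[OF x(1)] card_mono by (meson le_trans)
qed

text \<open>The \<open>2 * m\<close> disjoint classes have at least \<open>d\<close> elements each
  while \<open>V\<close> has at most \<open>2 * m * d\<close>, so equality holds throughout.\<close>

lemma card_V_eq: "card V = 2 * m * d"
  and card_cls: "a \<in> J \<Longrightarrow> card (cls a) = d"
proof -
  have J: "finite J" "card J = 2 * l" by (auto simp: J_def card_cartesian_product)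
  have "V = (\<Union>a\<in>J. cls a)" using c(1) by (auto simp: cls_def)
  moreover have "card (\<Union>a\<in>J. cls a) = (\<Sum>a\<in>J. card (cls a))"
    using J finite_V by (intro card_UN_disjoint) (auto simp: cls_def)
  ultimately have V: "card V = (\<Sum>a\<in>J. card (cls a))" by simp
  moreover have "(\<Sum>a\<in>J. d) \<le> (\<Sum>a\<in>J. card (cls a))" using card_cls_ge by (rule sum_mono)
  moreover have "(\<Sum>a\<in>J. d) = 2 * m * d" using J(2) by (simp add: l_eq_m[symmetric])
  ultimately have eq: "(\<Sum>a\<in>J. d) = (\<Sum>a\<in>J. card (cls a))" using card_V by linarith
  then show "card V = 2 * m * d" using V J(2) by (simp add: l_eq_m[symmetric])
  show "card (cls a) = d" if "a \<in> J"
    using sum_mono_inv[OF eq card_cls_ge that J(1)] by simp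
qed

text \<open>The neighbourhood has at least \<open>d\<close> elements and sits in a class with
  exactly \<open>d\<close>.\<close>

lemma N_eq_cls:
  assumes "x \<in> V" "x \<notin> C"
  shows "N x = cls (fst (c x), \<not> snd (c x))"
proof (rule card_seteq)
  have "(fst (c x), \<not> snd (c x)) \<in> J" using c(1)[OF assms(1)] by (auto simp: J_def)
  then show "card (cls (fst (c x), \<not> snd (c x))) \<le> card (N x)"
    using card_cls degree[OF assms(1)] by simp
qed (use N_subset_cls assms finite_V in \<open>auto simp: cls_def\<close>)

lemma edge_iff:
  assumes "x \<in> V" "y \<in> V"
  shows "(x, y) \<in> E \<longleftrightarrow> fst (c x) = fst (c y) \<and> snd (c x) \<noteq> snd (c y) \<or>
    (\<exists>i j. (i, j) \<in> parcs (cycle_graph l) \<and> x = v i \<and> y = v j)"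
    (is "_ \<longleftrightarrow> ?block \<or> ?cycle")
proof
  assume "(x, y) \<in> E"
  from edge_cases[OF this] show "?block \<or> ?cycle"
  proof
    assume "x \<in> C \<and> y \<in> C"
    then obtain i j where ij: "i < l" "j < l" "x = v i" "y = v j" by blast
    then have "(i, j) \<in> parcs (cycle_graph l)"
      using chordless[of i j] \<open>(x, y) \<in> E\<close> by (auto simp: cycle_graph_def)
    then show ?thesis using ij by blast
  qed simp
next
  assume "?block \<or> ?cycle"
  then show "(x, y) \<in> E"
  proof
    assume block: ?block
    show ?thesis
    proof (cases "x \<in> C")
      case True
      \<comment> \<open>Cycle vertices carry the flag \<open>False\<close>, so \<open>x\<close> and
        \<open>y\<close> cannot both be on the cycle.\<close>
      then have "y \<notin> C" using block c_v by auto
      then have "x \<in> N y"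
        using N_eq_cls[OF assms(2)] block assms by (auto simp: cls_def prod_eq_iff)
      then show ?thesis using N_sym by blast
    next
      case False
      then have "y \<in> N x"
        using N_eq_cls[OF assms(1)] block assms by (auto simp: cls_def prod_eq_iff)
      then show ?thesis by blast
    qed
  next
    assume ?cycle
    then show ?thesis using cycle_step sym by (auto simp: cycle_graph_def dest: symD)
  qed
qed

text \<open>Send \<open>x\<close> to its index, its side and its position in an enumeration of its
  class that starts with the representative.\<close>

lemma iso_BC:
  "\<exists>f. inj_on f V \<and> f ` V = pverts (BC l (card V)) \<and> map_prod f f ` E = parcs (BC l (card V))"
proof -
  have "\<exists>g. bij_betw g (cls a) {..<d} \<and> g (w a) = 0" if "a \<in> J" for a
  proof -
    have "finite (cls a)" using finite_V by (simp add: cls_def)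
    moreover have "w a \<in> cls a" using that c_w w_J_subset by (auto simp: cls_def simp del: w.simps)
    ultimately show ?thesis using bij_betw_lessThan_pointed[of "cls a" "w a"] card_cls[OF that] by metis
  qed
  then obtain g where g: "\<And>a. a \<in> J \<Longrightarrow> bij_betw (g a) (cls a) {..<d}"
      "\<And>a. a \<in> J \<Longrightarrow> g a (w a) = 0"
    by metis
  define f where "f x = (fst (c x), snd (c x), g (c x) x)" for x
  have in_cls: "x \<in> cls (c x)" if "x \<in> V" for x using that by (simp add: cls_def)
  have inj: "inj_on f V"
  proof (rule inj_onI)
    fix x y assume "x \<in> V" "y \<in> V" "f x = f y"
    then have "c x = c y" by (simp add: f_def prod_eq_iff)
    then have "g (c x) x = g (c x) y" using \<open>f x = f y\<close> by (simp add: f_def)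
    then show "x = y"
      using bij_betw_imp_inj_on[OF g(1)[OF c(1)]] in_cls \<open>x \<in> V\<close> \<open>y \<in> V\<close> \<open>c x = c y\<close>
      by (metis inj_onD)
  qed
  have d: "card V div (2 * l) = d" "0 < d" using card_V_eq l_eq_m m_ge d_large by auto
  have verts: "pverts (BC l (card V)) = {..<l} \<times> UNIV \<times> {..<d}"
    by (simp add: BC_def d)
  have bound: "fst (c x) < l" "g (c x) x < d" if "x \<in> V" for x
    using bij_betwE[OF g(1)[OF c(1)[OF that]]] in_cls[OF that] c(1)[OF that] by (auto simp: J_def)
  have image: "f ` V = {..<l} \<times> UNIV \<times> {..<d}"
  proof
    show "f ` V \<subseteq> {..<l} \<times> UNIV \<times> {..<d}"
      using bound by (auto simp: f_def)
    show "{..<l} \<times> UNIV \<times> {..<d} \<subseteq> f ` V"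
    proof
      fix p assume "p \<in> {..<l} \<times> (UNIV :: bool set) \<times> {..<d}"
      then obtain i s b where p: "p = (i, s, b)" "(i, s) \<in> J" "b < d" by (auto simp: J_def)
      then have "b \<in> g (i, s) ` cls (i, s)"
        using bij_betw_imp_surj_on[OF g(1)[OF p(2)]] by simp
      then obtain x where "x \<in> cls (i, s)" "g (i, s) x = b" by (auto simp only:)
      then show "p \<in> f ` V" using p by (auto simp: f_def cls_def image_iff intro!: bexI[of _ x])
    qed
  qed
  \<comment> \<open>Only \<open>v i\<close> is sent to the selected vertex of copy \<open>i\<close>,
    so the cycle arcs of \<open>BC\<close> correspond to the second case of
    \<open>edge_iff\<close>.\<close>
  have f_v: "f x = (i, False, 0) \<longleftrightarrow> x = v i" if "x \<in> V" "i < l" for x i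
  proof -
    have "f (v i) = (i, False, 0)"
      using c_v[OF that(2)] g(2)[of "(i, False)"] that by (simp add: f_def J_def)
    moreover have "v i \<in> V" using C_subset that by blast
    ultimately show ?thesis using inj that by (metis inj_onD)
  qed
  have arcs: "(x, y) \<in> E \<longleftrightarrow> (f x, f y) \<in> parcs (BC l (card V))" if "x \<in> V" "y \<in> V" for x y
  proof -
    have "(f x, f y) \<in> {((i, s, a), (i, s', b)) | i s s' a b. i < l \<and> s \<noteq> s' \<and> a < d \<and> b < d}
        \<longleftrightarrow> fst (c x) = fst (c y) \<and> snd (c x) \<noteq> snd (c y)"
      using bound[OF that(1)] bound[OF that(2)] by (auto simp: f_def)
    moreover have "(f x, f y) \<in> {((i, False, 0), (j, False, 0)) | i j.
          (i, j) \<in> parcs (cycle_graph l) \<and> 0 < d}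
        \<longleftrightarrow> (\<exists>i j. (i, j) \<in> parcs (cycle_graph l) \<and> x = v i \<and> y = v j)"
      (is "_ \<in> ?S \<longleftrightarrow> _")
    proof -
      have lt: "i < l \<and> j < l" if "(i, j) \<in> parcs (cycle_graph l)" for i j
        using that by (auto simp: cycle_graph_def)
      have "(a, b) \<in> ?S \<longleftrightarrow> (\<exists>i j. (i, j) \<in> parcs (cycle_graph l) \<and>
          a = (i, False, 0) \<and> b = (j, False, 0))" for a b
        using d(2) by (simp only: mem_Collect_eq prod.inject) metis
      moreover have "((i, j) \<in> parcs (cycle_graph l) \<and> f x = (i, False, 0) \<and> f y = (j, False, 0))
          \<longleftrightarrow> ((i, j) \<in> parcs (cycle_graph l) \<and> x = v i \<and> y = v j)" for i j
        using lt[of i j] f_v[OF that(1), of i] f_v[OF that(2), of j] by blast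
      ultimately show ?thesis by simp
    qed
    ultimately show ?thesis
      unfolding edge_iff[OF that] by (simp add: BC_def d)
  qed
  interpret BC: pair_graph "BC l (card V)" using pair_graph_BC l_ge by blast
  have "map_prod f f ` E = parcs (BC l (card V))"
  proof
    show "map_prod f f ` E \<subseteq> parcs (BC l (card V))" using arcs E_subset by auto
    show "parcs (BC l (card V)) \<subseteq> map_prod f f ` E"
    proof
      fix e assume e: "e \<in> parcs (BC l (card V))"
      then have "fst e \<in> f ` V" "snd e \<in> f ` V"
        using BC.wellformed image verts by blast+
      then obtain x y where xy: "x \<in> V" "y \<in> V" "e = (f x, f y)" by (metis imageE prod.collapse)
      then show "e \<in> map_prod f f ` E" using arcs e by (force simp: image_iff)
    qed
  qed
  then show ?thesis using inj image verts by auto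
qed

end

section \<open>Translation to digraphs\<close>

lemma out_degree_with_proj: "out_degree (with_proj G) x = card (parcs G `` {x})"
proof -
  have "out_arcs (with_proj G) x = Pair x ` (parcs G `` {x})"
    by (auto simp: out_arcs_def image_iff)
  then show ?thesis by (simp add: out_degree_def card_image inj_on_def)
qed

lemma contains_copy_cycle_graph:
  assumes "pair_graph G" "3 \<le> length cs"
    and path: "is_path (parcs G) cs (hd cs) (last cs)" and "(last cs, hd cs) \<in> parcs G"
  shows "contains_copy G (cycle_graph (length cs))"
proof -
  interpret G: pair_graph G by (fact assms(1))
  interpret H: pair_graph "cycle_graph (length cs)" by (rule pair_graph_cycle_graph[OF assms(2)])
  let ?n = "length cs"
  have "cs \<noteq> []" using path by (simp add: is_path_def)
  have edge: "(cs ! i, cs ! (Suc i mod ?n)) \<in> parcs G" if "i < ?n" for i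
  proof (cases "Suc i = ?n")
    case True
    then have "i = ?n - 1" by simp
    then show ?thesis
      using assms(4) \<open>cs \<noteq> []\<close> True by (simp add: last_conv_nth hd_conv_nth)
  next
    case False
    then show ?thesis using path that by (auto simp: is_path_def successively_conv_nth)
  qed
  have symG: "(b, a) \<in> parcs G" if "(a, b) \<in> parcs G" for a b
    using that G.pair_sym_arcs by (auto simp: symmetric_def dest: symD)
  have "inj_on ((!) cs) {..<?n}"
    using path by (auto simp: is_path_def inj_on_def nth_eq_iff_index_eq)
  moreover have "(!) cs ` {..<?n} \<subseteq> pverts G"
    using edge G.wellformed by force
  moreover have "map_prod ((!) cs) ((!) cs) ` parcs (cycle_graph ?n) \<subseteq> parcs G"
    using edge symG by (auto simp: cycle_graph_def)
  ultimately show ?thesis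
    unfolding contains_copy_iff[OF G.pair_wf_digraph_axioms H.pair_wf_digraph_axioms]
    by (intro exI[of _ "(!) cs"]) (simp add: cycle_graph_def)
qed

text \<open>After multiplication by \<open>m\<close> the left side is
  \<open>(4 * m ^ 4 + 2 * m ^ 3) * k\<close>, to be compared with
  \<open>54 * m ^ (2 * p) * k\<close>.\<close>

lemma degree_bound_arith:
  fixes p k d m :: nat
  assumes "1 \<le> p" "1 \<le> k" "m = 2 * p + 1" "108 * m ^ (2 * p) * k \<le> 2 * m * d"
  shows "m * (2 * m + 1) * (2 * m * k) < d"
proof -
  have "(4 * m ^ 4 + 2 * m ^ 3) * k < 54 * m ^ (2 * p) * k"
  \<comment> \<open>For \<open>p = 1\<close> the exponent is only \<open>2\<close>, but then
    \<open>m = 3\<close> and \<open>378 < 486\<close>; for larger \<open>p\<close>,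
    \<open>m ^ 4 \<le> m ^ (2 * p)\<close> suffices.\<close>
  proof (cases "p = 1")
    case True
    then show ?thesis using assms by (simp add: power2_eq_square eval_nat_numeral)
  next
    case False
    have "m ^ 4 \<le> m ^ (2 * p)" "m ^ 3 \<le> m ^ 4"
      using False assms by (auto intro!: power_increasing)
    moreover have "0 < m ^ 4" using assms by simp
    ultimately have "4 * m ^ 4 + 2 * m ^ 3 < 54 * m ^ (2 * p)" by linarith
    then show ?thesis using assms(2) by simp
  qed
  moreover have "(4 * m ^ 4 + 2 * m ^ 3) * k = m * (m * (2 * m + 1) * (2 * m * k))"
    by (simp add: algebra_simps eval_nat_numeral)
  ultimately have "m * (m * (2 * m + 1) * (2 * m * k)) < m * d" using assms(4) by linarith
  then show ?thesis by simp
qed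

theorem theorem2p5:
  fixes p k n :: nat
    and \<C> :: "nat pair_pre_digraph set"
    and G :: "'a pair_pre_digraph"
  assumes "1 \<le> p" and "1 \<le> k" and "1 \<le> n"
    and "4 * p + 1 \<le> k"
    and "108 * (2 * p + 1) ^ (2 * p) * k \<le> n"
    and "\<C> \<subseteq> odd_cycles"
    and "cycle_graph (2 * p + 1) \<notin> \<C>"
    and "\<forall>q. 1 \<le> q \<and> q < p \<longrightarrow> cycle_graph (2 * q + 1) \<in> \<C>"
    and "cycle_graph (2 * k + 1) \<in> \<C>"
    and "\<forall>q. k < q \<longrightarrow> cycle_graph (2 * q + 1) \<notin> \<C>"
    and "pair_graph G"
    and "card (pverts G) = n"
    and "\<forall>C \<in> \<C>. \<not> contains_copy G C"
    and "real (min_degree G) \<ge> real n / real (2 * (2 * p + 1))"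
  shows "bipartite G \<or>
    (2 * (2 * p + 1) dvd n \<and> digraph_iso (with_proj G) (with_proj (BC (2 * p + 1) n)))"
unfolding disj_imp
proof (rule impI)
  interpret G: pair_graph G by (fact assms(11))
  define V E m d where "V = pverts G" "E = parcs G" "m = 2 * p + 1" "d = min_degree G"
  note defs = this
  assume "\<not> bipartite G"
  have E: "E \<subseteq> V \<times> V" by (auto simp: defs dest: G.wellformed')
  have finV: "finite V" by (simp add: defs)
  have symE: "sym E"
    using G.pair_sym_arcs by (auto simp: symmetric_def defs)
  have irrefl: "(x, x) \<notin> E" for x using G.pair_no_loops[of "(x, x)"] by (auto simp: defs)
  have degree: "d \<le> card (E `` {x})" if "x \<in> V" for x
    unfolding defs min_degree_def out_degree_with_proj[symmetric]
    using that finV by (intro Min_le) (auto simp: defs)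
  have "real n \<le> real (2 * m * d)"
    using assms(14) by (simp add: defs field_simps)
  then have n_le: "n \<le> 2 * m * d" by (simp only: of_nat_le_iff)
  have no_cycle: "(last cs, hd cs) \<notin> E"
    if "cycle_graph (length cs) \<in> \<C>" "3 \<le> length cs" "is_path E cs (hd cs) (last cs)" for cs
    using contains_copy_cycle_graph[OF assms(11) that(2)] that assms(13) by (auto simp: defs)
  have dense: "dense_graph V E m k d"
  proof
    show "m * (2 * m + 1) * (2 * m * k) < d"
      using degree_bound_arith[of p k m d] assms n_le by (simp add: defs)
    show "(last cs, hd cs) \<notin> E" if "length cs = 2 * k + 1" "is_path E cs (hd cs) (last cs)" for cs
      using no_cycle[of cs] that assms by simp
  qed (use finV E symE irrefl degree n_le assms in \<open>auto simp: defs\<close>)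
  have "\<not> (\<forall>x n. odd n \<longrightarrow> (x, x) \<notin> E ^^ n)"
    using two_colouring_if_no_odd_closed_walk[OF symE E] \<open>\<not> bipartite G\<close>
    unfolding bipartite_def defs by blast
  then obtain v l where "shortest_odd_walk E v l" using shortest_odd_walk_exists[OF symE] by blast
  then interpret W: shortest_odd_walk E v l .
  interpret D: dense_graph V E m k d by (fact dense)
  have "l \<noteq> 1"
  proof
    assume "l = 1"
    then show False using W.step[of 0] W.closed irrefl by simp
  qed
  then have l3: "3 \<le> l" using W.odd_l by (cases l rule: nat.exhaust) (auto elim!: oddE)
  \<comment> \<open>A shortest odd closed walk traces a cycle of \<open>G\<close>, so its length is
    not an excluded one.\<close>
  have cycle: "cycle_graph l \<notin> \<C>"
  proof
    assume "cycle_graph l \<in> \<C>"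
    let ?cs = "map v [0..<l]"
    have "successively (\<lambda>a b. (a, b) \<in> E) ?cs"
      using W.step by (auto simp: successively_conv_nth)
    moreover have "distinct ?cs" using W.inj by (simp add: distinct_map lessThan_atLeast0)
    ultimately have "is_path E ?cs (hd ?cs) (last ?cs)" using l3 by (simp add: is_path_def)
    then have "(last ?cs, hd ?cs) \<notin> E"
      using no_cycle[of ?cs] l3 \<open>cycle_graph l \<in> \<C>\<close> by simp
    moreover have "(v (l - 1), v 0) \<in> E" using W.step[of "l - 1"] W.closed l3 by simp
    ultimately show False using l3 by (simp add: last_map hd_map)
  qed
  \<comment> \<open>For \<open>l = 3\<close> the bound is immediate; longer cycles are bounded by
    double counting.\<close>
  have l_le: "l \<le> 4 * m"
  proof (cases "5 \<le> l")
    case True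
    have "l * d \<le> 2 * card V" using W.length_times_degree[OF True finV E degree] .
    also have "\<dots> \<le> 2 * (2 * m * d)" using D.card_V by (rule mult_le_mono2)
    finally show ?thesis using D.d_large by simp
  qed (simp add: defs)
  \<comment> \<open>Since \<open>4 * m \<le> 2 * k + 2\<close> and \<open>l\<close> is odd,
    \<open>l \<le> 2 * k + 1\<close>; equality fails because \<open>2 * k + 1\<close> is an excluded
    length.\<close>
  have "l \<noteq> 4 * m" "l \<noteq> 2 * k" "l \<noteq> 2 * k + 1" using W.odd_l cycle assms(9) by auto
  then have "l < 2 * k" using l_le assms(4) by (simp add: defs)
  \<comment> \<open>All odd cycles shorter than \<open>2 * p + 1\<close> belong to the
    family.\<close>
  have "m \<le> l"
  proof (rule ccontr)
    assume "\<not> m \<le> l"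
    obtain q where q: "l = 2 * q + 1" using W.odd_l by (auto elim: oddE)
    then have "1 \<le> q \<and> q < p" using l3 \<open>\<not> m \<le> l\<close> by (simp add: defs)
    then show False using assms(8) cycle q by simp
  qed
  interpret X: extremal_graph V E m k d v l
    using W.odd_l l3 \<open>l < 2 * k\<close> l_le W.inj W.cycle_step \<open>m \<le> l\<close> W.chordless
    by unfold_locales auto
  have "n = 2 * m * d" using X.card_V_eq assms(12) by (simp only: defs(1))
  then have "2 * m dvd n" by simp
  moreover have "digraph_iso (with_proj G) (with_proj (BC m n))"
    using X.iso_BC assms(12) X.l_eq_m
    unfolding digraph_iso_with_proj_iff[OF G.pair_wf_digraph_axioms] by (simp add: defs)
  ultimately show "2 * (2 * p + 1) dvd n \<and> digraph_iso (with_proj G) (with_proj (BC (2 * p + 1) n))"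
    by (simp add: defs)
qed

end
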